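(* Let $R=K[x_1,\dots,x_n]$ be a polynomial ring over a field $K$ and let $I\subset R$ be a symmetric strongly shifted ideal all of whose minimal monomial generators have the same degree. Then $I$ is of fiber type. Moreover, the defining ideal of the Rees algebra of $I$ is generated in bidegrees $(0,* )$ and $(1,1)$, i.e. by elements whose bidegree is $(1,1)$ or $(0,k)$ for some $k$.
   Context: $\mathfrak S_n$ acts on $R$ by permuting variables. $P_n=\{\lambda\in\mathbb Z^n: 0\le\lambda_1\le\cdots\le\lambda_n\}$, $x^\lambda=x_1^{\lambda_1}\cdots x_n^{\lambda_n}$. For an $\mathfrak S_n$-fixed monomial ideal $I$ put $P(I)=\{\lambda\in P_n: x^\lambda\in I\}$. An $\mathfrak S_n$-fixed monomial ideal $I$ is symmetric strongly shifted if for every $\lambda\in P(I)$ and $1\le i<j\le n$ with $\lambda_i<\lambda_j$ one has $x^\lambda x_i/x_j\in I$. Let $f_1,\dots,f_s$ be the minimal monomial generators of $I$, $S=R[T_1,\dots,T_s]$, and let $\varphi:S\to \mathcal R(I)=\bigoplus_{i\ge0}I^it^i\subseteq R[t]$ be the surjective $R$-algebra map $T_i\mapsto f_it$. The defining ideal of the Rees algebra is $\mathcal K=\ker\varphi$. Let $\mathcal L\subseteq\mathcal K$ be the ideal generated by the elements of $\mathcal K$ that are linear forms in $T_1,\dots,T_s$ (equivalently, the kernel of the natural map $S\to\mathrm{Sym}(I)$), and let $\mathcal J\subseteq K[T_1,\dots,T_s]$ be the kernel of the induced map $K[T_1,\dots,T_s]\to\mathcal R(I)/(x_1,\dots,x_n)\mathcal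 R(I)$. The ideal $I$ is of fiber type if $\mathcal K=\mathcal L+\mathcal JS$. The bigrading on $S$ is given by $\deg(r)=(\deg_R(r),0)$ for homogeneous $r\in R$ and $\deg(T_i)=(0,1)$. *)

theory Defs
  imports
    "HOL-Library.Poly_Mapping"
    "HOL-Computational_Algebra.Polynomial"
    "HOL-Algebra.QuotRing"
    "HOL-Algebra.Ideal_Product"
begin

text \<open>
  The index set \<open>{1, \<dots>, n}\<close> of the variables of \<open>R\<close> is a type \<open>'n\<close> of sort \<open>{finite, linorder}\<close>.
  The monomial with exponent vector \<open>m\<close> is represented by \<open>m\<close> itself as a finitely supported
  function, and \<open>R\<close> is the monoid ring over these, with the convolution product.
\<close>

type_synonym 'i mon = "'i \<Rightarrow>\<^sub>0 nat"
type_synonym ('n, 'k) R = "'n mon \<Rightarrow>\<^sub>0 'k"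

text \<open>\<open>R[T\<^sub>1, T\<^sub>2, \<dots>]\<close>; the polynomial ring in \<open>T\<^sub>1, \<dots>, T\<^sub>s\<close> is carved out by \<open>S_ring\<close> below.\<close>

type_synonym ('n, 'k) RT = "nat mon \<Rightarrow>\<^sub>0 ('n, 'k) R"

abbreviation exponent :: "'i mon \<Rightarrow> 'i \<Rightarrow> nat" where
  "exponent \<equiv> Poly_Mapping.lookup"

abbreviation coefficient :: "('m \<Rightarrow>\<^sub>0 'a) \<Rightarrow> 'm \<Rightarrow> 'a::zero" where
  "coefficient \<equiv> Poly_Mapping.lookup"

definition mdeg :: "'i mon \<Rightarrow> nat" where
  "mdeg m = (\<Sum>i\<in>Poly_Mapping.keys m. exponent m i)"

definition xpow :: "'n mon \<Rightarrow> ('n, 'k::field) R" where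
  "xpow m = Poly_Mapping.single m 1"

text \<open>A subset of a type-class ring, closed under the ring operations, as a ring in the sense of
  \<^theory>\<open>HOL-Algebra.Ring\<close>.\<close>

definition ring_on :: "'a::comm_ring_1 set \<Rightarrow> 'a ring" where
  "ring_on A = \<lparr>carrier = A, mult = (*), one = 1, zero = 0, add = (+)\<rparr>"

abbreviation R_ring :: "('n, 'k::field) R ring" where
  "R_ring \<equiv> ring_on UNIV"


section \<open>Symmetric strongly shifted ideals\<close>

definition monomial_ideal :: "('n, 'k::field) R set \<Rightarrow> bool" where
  "monomial_ideal I \<longleftrightarrow> (\<exists>M. I = Idl\<^bsub>R_ring\<^esub> (xpow ` M))"

text \<open>The permutation \<open>\<sigma>\<close> sends \<open>x\<^sub>i\<close> to the variable with index \<open>\<sigma> i\<close>, so the exponent of \<open>x\<^sub>i\<close> in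
  the image of a monomial \<open>m\<close> is the exponent of the variable \<open>\<sigma>\<^sup>-\<^sup>1 i\<close> in \<open>m\<close>.\<close>

definition perm_mon :: "('n \<Rightarrow> 'n) \<Rightarrow> 'n mon \<Rightarrow> 'n mon" where
  "perm_mon \<sigma> m = Poly_Mapping.map_key (inv_into UNIV \<sigma>) m"

definition perm_act :: "('n \<Rightarrow> 'n) \<Rightarrow> ('n, 'k::field) R \<Rightarrow> ('n, 'k) R" where
  "perm_act \<sigma> p =
     (\<Sum>m\<in>Poly_Mapping.keys p. Poly_Mapping.single (perm_mon \<sigma> m) (coefficient p m))"

definition sym_fixed :: "('n, 'k::field) R set \<Rightarrow> bool" where
  "sym_fixed I \<longleftrightarrow> (\<forall>\<sigma>. bij \<sigma> \<longrightarrow> perm_act \<sigma> ` I = I)"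

definition partitions :: "('n::{finite, linorder}) mon set" where
  "partitions = {l. mono (exponent l)}"

definition partitions_of :: "('n::{finite, linorder}, 'k::field) R set \<Rightarrow> 'n mon set" where
  "partitions_of I = {l \<in> partitions. xpow l \<in> I}"

text \<open>In the following, subtraction of exponent vectors does not truncate, as
  \<open>l\<^sub>j > l\<^sub>i \<ge> 0\<close>.\<close>

definition symmetric_strongly_shifted :: "('n::{finite, linorder}, 'k::field) R set \<Rightarrow> bool" where
  "symmetric_strongly_shifted I \<longleftrightarrow>
     monomial_ideal I \<and> sym_fixed I \<and>
     (\<forall>l\<in>partitions_of I. \<forall>i j. i < j \<and> exponent l i < exponent l j \<longrightarrow>
        xpow (l + Poly_Mapping.single i 1 - Poly_Mapping.single j 1) \<in> I)"

text \<open>\<open>x\<^bsup>f 1\<^esup>, \<dots>, x\<^bsup>f s\<^esup>\<close> are the minimal monomial generators of \<open>I\<close>, listed without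
  repetition.\<close>

definition min_mon_gens :: "('n, 'k::field) R set \<Rightarrow> nat \<Rightarrow> (nat \<Rightarrow> 'n mon) \<Rightarrow> bool" where
  "min_mon_gens I s f \<longleftrightarrow>
     inj_on f {1..s} \<and>
     Idl\<^bsub>R_ring\<^esub> (xpow ` f ` {1..s}) = I \<and>
     (\<forall>M. M \<subset> f ` {1..s} \<longrightarrow> Idl\<^bsub>R_ring\<^esub> (xpow ` M) \<noteq> I)"


section \<open>The Rees algebra and its defining ideal\<close>

primrec ideal_power :: "('n, 'k::field) R set \<Rightarrow> nat \<Rightarrow> ('n, 'k) R set" where
  "ideal_power I 0 = UNIV"
| "ideal_power I (Suc d) = I \<cdot>\<^bsub>R_ring\<^esub> ideal_power I d"

definition rees_algebra :: "('n, 'k::field) R set \<Rightarrow> ('n, 'k) R poly ring" where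
  "rees_algebra I = ring_on {p. \<forall>d. poly.coeff p d \<in> ideal_power I d}"

definition S_ring :: "nat \<Rightarrow> ('n, 'k::field) RT ring" where
  "S_ring s = ring_on {F. \<forall>\<alpha>\<in>Poly_Mapping.keys F. Poly_Mapping.keys \<alpha> \<subseteq> {1..s}}"

text \<open>The evaluation \<open>T\<^sub>i \<mapsto> x\<^bsup>f i\<^esup> t\<close>.\<close>

definition rees_map :: "(nat \<Rightarrow> 'n mon) \<Rightarrow> ('n, 'k::field) RT \<Rightarrow> ('n, 'k) R poly" where
  "rees_map f F =
     (\<Sum>\<alpha>\<in>Poly_Mapping.keys F.
        [:coefficient F \<alpha>:] *
        (\<Prod>i\<in>Poly_Mapping.keys \<alpha>. Polynomial.monom (xpow (f i)) 1 ^ exponent \<alpha> i))"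

definition rees_ideal :: "('n, 'k::field) R set \<Rightarrow> nat \<Rightarrow> (nat \<Rightarrow> 'n mon) \<Rightarrow> ('n, 'k) RT set" where
  "rees_ideal I s f = a_kernel (S_ring s) (rees_algebra I) (rees_map f)"


section \<open>Fiber type\<close>

definition T_linear_form :: "('n, 'k::field) RT \<Rightarrow> bool" where
  "T_linear_form F \<longleftrightarrow> (\<forall>\<alpha>\<in>Poly_Mapping.keys F. mdeg \<alpha> = 1)"

definition linear_ideal :: "('n, 'k::field) R set \<Rightarrow> nat \<Rightarrow> (nat \<Rightarrow> 'n mon) \<Rightarrow> ('n, 'k) RT set" where
  "linear_ideal I s f = Idl\<^bsub>S_ring s\<^esub> {F \<in> rees_ideal I s f. T_linear_form F}"

text \<open>\<open>K[T\<^sub>1, \<dots>, T\<^sub>s]\<close> as a subring of \<open>S\<close>\<close>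

definition KT_ring :: "nat \<Rightarrow> ('n, 'k::field) RT ring" where
  "KT_ring s = ring_on {F \<in> carrier (S_ring s). \<forall>\<alpha>. \<exists>c. coefficient F \<alpha> = Poly_Mapping.single 0 c}"

text \<open>\<open>(x\<^sub>1, \<dots>, x\<^sub>n) \<R>(I)\<close>\<close>

definition rees_irrelevant :: "('n, 'k::field) R set \<Rightarrow> ('n, 'k) R poly set" where
  "rees_irrelevant I =
     Idl\<^bsub>rees_algebra I\<^esub> (range (\<lambda>i. [:xpow (Poly_Mapping.single i 1):]))"

definition fiber_ideal :: "('n, 'k::field) R set \<Rightarrow> nat \<Rightarrow> (nat \<Rightarrow> 'n mon) \<Rightarrow> ('n, 'k) RT set" where
  "fiber_ideal I s f =
     a_kernel (KT_ring s) (rees_algebra I Quot rees_irrelevant I)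
       (\<lambda>F. rees_irrelevant I +>\<^bsub>rees_algebra I\<^esub> rees_map f F)"

definition fiber_type :: "('n, 'k::field) R set \<Rightarrow> nat \<Rightarrow> (nat \<Rightarrow> 'n mon) \<Rightarrow> bool" where
  "fiber_type I s f \<longleftrightarrow>
     rees_ideal I s f =
       linear_ideal I s f <+>\<^bsub>S_ring s\<^esub> Idl\<^bsub>S_ring s\<^esub> (fiber_ideal I s f)"

text \<open>\<open>F\<close> is bihomogeneous of bidegree \<open>(a, b)\<close>; zero has every bidegree.\<close>

definition has_bidegree :: "('n, 'k::field) RT \<Rightarrow> nat \<Rightarrow> nat \<Rightarrow> bool" where
  "has_bidegree F a b \<longleftrightarrow>
     (\<forall>\<alpha>\<in>Poly_Mapping.keys F. mdeg \<alpha> = b \<and>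
        (\<forall>m\<in>Poly_Mapping.keys (coefficient F \<alpha>). mdeg m = a))"

end

theory Submission
  imports Defs
begin

text \<open>
  The defining ideal is spanned by the binomials \<open>x\<^sup>a T\<^sup>\<alpha> - x\<^sup>b T\<^sup>\<beta>\<close> with equal images. For a symmetric
  ideal, being strongly shifted means that a generator \<open>u\<close> with \<open>u\<^sub>i < u\<^sub>j\<close> can be replaced by
  \<open>x\<^sub>i u / x\<^sub>j\<close>, for all \<open>i\<close> and \<open>j\<close>. Such exchanges in one factor, each of them a multiple of a relation
  \<open>x\<^sub>i T\<^sub>u - x\<^sub>j T\<^sub>v\<close> of bidegree \<open>(1,1)\<close>, bring the two products of generators closer to each other
  until they agree; what is left is a multiple of a relation \<open>T\<^sup>\<alpha> - T\<^sup>\<beta>\<close>. The fiber relations are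
  relations of the Rees algebra, as the coefficient of \<open>t\<^sup>k\<close> in their image is homogeneous of
  degree \<open>k d\<close>, whereas in \<open>(x\<^sub>1, \<dots>, x\<^sub>n) \<R>(I)\<close> its terms have degree at least \<open>k d + 1\<close>.
\<close>


section \<open>Ideals of subrings of a type-class ring\<close>

text \<open>Only closure is asked for, since the ring axioms themselves are inherited from the type
  class. The subrings in play are all of the form \<open>ring_on A\<close>.\<close>

definition subring_set :: "'a::comm_ring_1 set \<Rightarrow> bool" where
  "subring_set A \<longleftrightarrow> 0 \<in> A \<and> 1 \<in> A \<and> (\<forall>a\<in>A. \<forall>b\<in>A. a + b \<in> A \<and> a * b \<in> A) \<and> (\<forall>a\<in>A. - a \<in> A)"

lemma ring_on_simps [simp]:
  "carrier (ring_on A) = A" "mult (ring_on A) = (*)" "one (ring_on A) = 1"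
  "zero (ring_on A) = 0" "add (ring_on A) = (+)"
  by (simp_all add: ring_on_def)

lemma ring_ring_on:
  assumes "subring_set A"
  shows "ring (ring_on A)"
proof (rule ringI)
  show "abelian_group (ring_on A)"
    using assms by (intro abelian_groupI)
      (auto simp: subring_set_def algebra_simps intro: bexI[of _ "- x" for x])
  show "Group.monoid (ring_on A)"
    using assms by (intro monoidI) (auto simp: subring_set_def algebra_simps)
qed (auto simp: algebra_simps)

text \<open>Negation is multiplication by \<open>- 1\<close>, which lies in \<open>A\<close>, and
  commutativity turns left absorption into right absorption. This reduces ideals of the
  carrier-based rings to plain closure conditions.\<close>

lemma ideal_ring_on_iff:
  assumes A: "subring_set A"
  shows "ideal J (ring_on A) \<longleftrightarrow>
    J \<subseteq> A \<and> 0 \<in> J \<and> (\<forall>a\<in>J. \<forall>b\<in>J. a + b \<in> J) \<and> (\<forall>a\<in>A. \<forall>b\<in>J. a * b \<in> J)"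
    (is "_ \<longleftrightarrow> ?closed")
proof
  assume "ideal J (ring_on A)"
  then interpret ideal J "ring_on A" .
  show ?closed
    using a_subset additive_subgroup.zero_closed[OF is_additive_subgroup]
      additive_subgroup.a_closed[OF is_additive_subgroup] I_l_closed by auto
next
  assume closed: ?closed
  interpret ring "ring_on A" using A by (rule ring_ring_on)
  have neg: "- a \<in> J" if "a \<in> J" for a
    using that A closed[THEN conjunct2, THEN conjunct2, THEN conjunct2, rule_format, of "- 1" a]
    by (simp add: subring_set_def)
  have "\<ominus>\<^bsub>ring_on A\<^esub> a = - a" if "a \<in> J" for a
    using that neg[OF that] closed by (intro minus_equality) auto
  then have "subgroup J (add_monoid (ring_on A))"
    using closed neg by (intro add.subgroupI) auto
  moreover have "a * x \<in> J" if "a \<in> J" "x \<in> A" for a x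
    using closed that by (metis mult.commute)
  ultimately show "ideal J (ring_on A)"
    using closed by (intro idealI ring_axioms) auto
qed

lemma subring_set_UNIV: "subring_set UNIV"
  by (simp add: subring_set_def)


section \<open>Monomials\<close>

abbreviation var :: "'i \<Rightarrow> 'i mon" where
  "var i \<equiv> Poly_Mapping.single i (Suc 0)"

lemma exponent_var: "exponent (var i) j = (if i = j then 1 else 0)"
  by (simp add: lookup_single when_def)

lemma poly_mapping_sum_single:
  "p = (\<Sum>k\<in>Poly_Mapping.keys p. Poly_Mapping.single k (Poly_Mapping.lookup p k))"
  by (rule poly_mapping_eqI)
    (auto simp: lookup_sum lookup_single when_def in_keys_iff)

lemma mdeg_add: "mdeg (a + b) = mdeg a + mdeg b"
  unfolding mdeg_def by (rule setsum_keys_plus_distrib) auto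

lemma mdeg_zero [simp]: "mdeg 0 = 0"
  by (simp add: mdeg_def)

lemma mdeg_single [simp]: "mdeg (Poly_Mapping.single i k) = k"
  by (simp add: mdeg_def)

lemma mdeg_UNIV: "mdeg (m :: 'n::finite mon) = (\<Sum>i\<in>UNIV. exponent m i)"
  unfolding mdeg_def by (rule sum.mono_neutral_left) (auto simp: in_keys_iff)

lemma mon_split_var:
  assumes "0 < exponent m i"
  obtains m' where "m = m' + var i"
proof
  show "m = (m - var i) + var i"
    using assms by (intro poly_mapping_eqI) (auto simp: lookup_add lookup_minus exponent_var)
qed

lemma mon_mdeg_eq_obtain_less:
  fixes p q :: "'n::finite mon"
  assumes "mdeg p = mdeg q" and "p \<noteq> q"
  obtains i where "exponent p i < exponent q i"
proof (rule ccontr)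
  assume "\<not> thesis"
  then have le: "exponent q i \<le> exponent p i" for i
    using that by (meson not_le)
  moreover obtain i where "exponent p i \<noteq> exponent q i"
    using assms(2) by (metis poly_mapping_eqI)
  ultimately have "exponent q i < exponent p i" by (metis order.not_eq_order_implies_strict)
  then have "mdeg q < mdeg p"
    unfolding mdeg_UNIV using le by (intro sum_strict_mono_ex1) auto
  then show False using assms by simp
qed

lemma mon_dvd_mdeg_eq:
  fixes g u m :: "'n mon"
  assumes "u = m + g" and "mdeg u = mdeg g"
  shows "u = g"
proof -
  have "mdeg m = 0" using assms by (simp add: mdeg_add)
  then have "m = 0" unfolding mdeg_def by (intro poly_mapping_eqI) (auto simp: in_keys_iff)
  then show ?thesis using assms by simp
qed

lemma xpow_add: "xpow (a + b) = xpow a * xpow b"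
  by (simp add: xpow_def mult_single)

lemma xpow_zero [simp]: "xpow 0 = 1"
  by (simp add: xpow_def)

lemma keys_xpow [simp]: "Poly_Mapping.keys (xpow m :: ('n, 'k::field) R) = {m}"
  by (simp add: xpow_def)

text \<open>The exponent vector of the product of generators that \<open>T^\<alpha>\<close> stands
  for. Monomials are written additively, so a power becomes a sum of equal summands.\<close>

definition mon_power :: "(nat \<Rightarrow> 'n mon) \<Rightarrow> nat mon \<Rightarrow> 'n mon" where
  "mon_power f \<alpha> = (\<Sum>i\<in>Poly_Mapping.keys \<alpha>. \<Sum>_<exponent \<alpha> i. f i)"

lemma sum_lessThan_const_add:
  fixes x :: "'n mon"
  shows "(\<Sum>_<a + b. x) = (\<Sum>_<a. x) + (\<Sum>_<b::nat. x)"
  by (induction b) (simp_all add: add.assoc)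

lemma mon_power_add: "mon_power f (\<alpha> + \<beta>) = mon_power f \<alpha> + mon_power f \<beta>"
  unfolding mon_power_def
  by (rule setsum_keys_plus_distrib[where f = "\<lambda>i c. \<Sum>_<c. f i"]) (auto simp: sum_lessThan_const_add)

lemma mon_power_var [simp]: "mon_power f (var i) = f i"
  by (simp add: mon_power_def)

lemma exponent_mon_power:
  "exponent (mon_power f \<alpha>) i = (\<Sum>a\<in>Poly_Mapping.keys \<alpha>. exponent \<alpha> a * exponent (f a) i)"
  by (simp add: mon_power_def lookup_sum)

lemma mdeg_sum: "mdeg (sum g A) = (\<Sum>a\<in>A. mdeg (g a))"
  by (induction A rule: infinite_finite_induct) (auto simp: mdeg_add)

lemma mdeg_mon_power:
  assumes "\<And>a. a \<in> Poly_Mapping.keys \<alpha> \<Longrightarrow> mdeg (f a) = d"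
  shows "mdeg (mon_power f \<alpha>) = mdeg \<alpha> * d"
  using assms by (simp add: mon_power_def mdeg_sum mdeg_def[of \<alpha>] sum_distrib_right)


section \<open>The map onto the Rees algebra\<close>

abbreviation mono_term :: "'n mon \<Rightarrow> nat mon \<Rightarrow> 'k::field \<Rightarrow> ('n, 'k) RT" where
  "mono_term m \<alpha> c \<equiv> Poly_Mapping.single \<alpha> (Poly_Mapping.single m c)"

abbreviation poly_terms :: "('n, 'k::field) RT \<Rightarrow> (nat mon \<times> 'n mon) set" where
  "poly_terms F \<equiv> (SIGMA \<alpha>:Poly_Mapping.keys F. Poly_Mapping.keys (coefficient F \<alpha>))"

lemma sum_mono_terms:
  fixes F :: "('n, 'k::field) RT"
  shows "F = (\<Sum>(\<alpha>, m)\<in>poly_terms F. mono_term m \<alpha> (coefficient (coefficient F \<alpha>) m))"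
proof -
  have single_sum: "Poly_Mapping.single \<alpha> (sum g B) = (\<Sum>b\<in>B. Poly_Mapping.single \<alpha> (g b))"
    for \<alpha> :: "nat mon" and g :: "'a \<Rightarrow> ('n, 'k) R" and B :: "'a set"
    by (induction B rule: infinite_finite_induct) (auto simp: single_add)
  have "F = (\<Sum>\<alpha>\<in>Poly_Mapping.keys F. Poly_Mapping.single \<alpha> (coefficient F \<alpha>))"
    by (rule poly_mapping_sum_single)
  also have "\<dots> = (\<Sum>\<alpha>\<in>Poly_Mapping.keys F. \<Sum>m\<in>Poly_Mapping.keys (coefficient F \<alpha>).
      mono_term m \<alpha> (coefficient (coefficient F \<alpha>) m))"
    unfolding single_sum[symmetric] poly_mapping_sum_single[symmetric] ..
  finally show ?thesis by (simp add: sum.Sigma)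
qed

lemma finite_poly_terms: "finite (poly_terms F)"
  by simp

lemma mem_poly_terms: "(\<alpha>, m) \<in> poly_terms F \<longleftrightarrow> coefficient (coefficient F \<alpha>) m \<noteq> 0"
  by (auto simp: in_keys_iff)

lemma prod_T_images:
  "(\<Prod>i\<in>Poly_Mapping.keys \<alpha>. Polynomial.monom (xpow (f i) :: ('n, 'k::field) R) 1 ^ exponent \<alpha> i)
     = Polynomial.monom (xpow (mon_power f \<alpha>)) (mdeg \<alpha>)"
proof -
  have "(xpow m :: ('n, 'k) R) ^ k = xpow (\<Sum>_<k. m)" for m :: "'n mon" and k :: nat
    by (induction k) (simp_all add: xpow_add mult.commute)
  moreover have "(\<Prod>i\<in>A. Polynomial.monom (xpow (g i) :: ('n, 'k) R) (h i)) = Polynomial.monom (xpow (sum g A)) (sum h A)"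
    if "finite A" for A and g :: "nat \<Rightarrow> 'n mon" and h :: "nat \<Rightarrow> nat"
    using that by (induction A) (simp_all add: xpow_add mult_monom monom_0 one_pCons)
  ultimately show ?thesis
    by (simp add: monom_power mon_power_def mdeg_def)
qed

lemma rees_map_add: "rees_map f (F + G) = rees_map f F + rees_map f G"
  unfolding rees_map_def
  by (rule setsum_keys_plus_distrib[where f = "\<lambda>\<alpha> c. [:c:] * (\<Prod>i\<in>Poly_Mapping.keys \<alpha>.
      Polynomial.monom (xpow (f i)) 1 ^ exponent \<alpha> i)"])
    (auto simp: algebra_simps simp flip: smult_add_left)

lemma rees_map_zero [simp]: "rees_map f 0 = 0"
  by (simp add: rees_map_def)

lemma rees_map_diff: "rees_map f (F - G) = rees_map f F - rees_map f G"
  using rees_map_add[of f "F - G" G] by simp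

lemma rees_map_sum: "rees_map f (sum g A) = (\<Sum>a\<in>A. rees_map f (g a))"
  by (induction A rule: infinite_finite_induct) (auto simp: rees_map_add)

lemma rees_map_single:
  "rees_map f (Poly_Mapping.single \<alpha> c) = Polynomial.monom (c * xpow (mon_power f \<alpha>)) (mdeg \<alpha>)"
  by (cases "c = 0") (simp_all add: rees_map_def prod_T_images smult_monom del: One_nat_def)

lemma rees_map_mono_term:
  "rees_map f (mono_term m \<alpha> c)
     = Polynomial.monom (Poly_Mapping.single (m + mon_power f \<alpha>) c) (mdeg \<alpha>)"
  by (simp add: rees_map_single xpow_def mult_single)

text \<open>Both sides are biadditive in \<open>F\<close> and \<open>G\<close>, so it suffices to
  compare them on single terms in the \<open>T\<close> variables, where the exponents of
  \<open>x\<close>, \<open>T\<close> and \<open>t\<close> simply add up.\<close>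

lemma rees_map_mult: "rees_map f (F * G) = rees_map f F * rees_map f G"
proof -
  let ?s = "\<lambda>F \<alpha>. Poly_Mapping.single \<alpha> (coefficient F \<alpha>)"
  have "rees_map f (?s F \<alpha> * ?s G \<beta>) = rees_map f (?s F \<alpha>) * rees_map f (?s G \<beta>)" for \<alpha> \<beta>
    by (simp add: mult_single rees_map_single mult_monom mon_power_add mdeg_add xpow_add algebra_simps)
  then have "rees_map f (sum (?s F) A * sum (?s G) B) = rees_map f (sum (?s F) A) * rees_map f (sum (?s G) B)"
    for A B
    by (simp add: sum_product rees_map_sum)
  from this[of "Poly_Mapping.keys F" "Poly_Mapping.keys G"] show ?thesis
    by (simp only: poly_mapping_sum_single[symmetric])
qed

text \<open>Each term of \<open>F\<close> goes to a single monomial times a power of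
  \<open>t\<close>, so a coefficient of the image collects exactly the terms of \<open>F\<close>
  lying over one monomial. This is what makes the kernel binomial.\<close>

lemma coeff_rees_map:
  "coefficient (poly.coeff (rees_map f F) k) w
     = (\<Sum>(\<alpha>, m)\<in>poly_terms F.
          if mdeg \<alpha> = k \<and> m + mon_power f \<alpha> = w then coefficient (coefficient F \<alpha>) m else 0)"
proof -
  have "rees_map f F = (\<Sum>(\<alpha>, m)\<in>poly_terms F.
      Polynomial.monom (Poly_Mapping.single (m + mon_power f \<alpha>) (coefficient (coefficient F \<alpha>) m)) (mdeg \<alpha>))"
    by (subst sum_mono_terms) (simp add: rees_map_sum case_prod_unfold rees_map_mono_term)
  then show ?thesis
    by (auto simp: coeff_sum lookup_sum lookup_single when_def case_prod_unfold intro!: sum.cong)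
qed

section \<open>The polynomial ring \<open>S\<close> and its ideals\<close>

abbreviation S_carrier :: "nat \<Rightarrow> ('n, 'k::field) RT set" where
  "S_carrier s \<equiv> carrier (S_ring s)"

lemma mem_S_carrier: "F \<in> S_carrier s \<longleftrightarrow> (\<forall>\<alpha>\<in>Poly_Mapping.keys F. Poly_Mapping.keys \<alpha> \<subseteq> {1..s})"
  by (simp add: S_ring_def)

lemma S_ring_eq: "S_ring s = ring_on (S_carrier s)"
  by (simp add: S_ring_def)

lemma subring_set_S: "subring_set (S_carrier s :: ('n, 'k::field) RT set)"
  unfolding subring_set_def
proof (intro conjI ballI)
  fix F G :: "('n, 'k) RT"
  assume F: "F \<in> S_carrier s" and G: "G \<in> S_carrier s"
  show "F + G \<in> S_carrier s"
    using F G keys_add[of F G] unfolding mem_S_carrier by blast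
  show "F * G \<in> S_carrier s"
    unfolding mem_S_carrier
  proof
    fix \<gamma> assume "\<gamma> \<in> Poly_Mapping.keys (F * G)"
    then obtain \<alpha> \<beta> where "\<alpha> \<in> Poly_Mapping.keys F" "\<beta> \<in> Poly_Mapping.keys G" "\<gamma> = \<alpha> + \<beta>"
      using keys_mult[of F G] by blast
    then show "Poly_Mapping.keys \<gamma> \<subseteq> {1..s}"
      using F G keys_add[of \<alpha> \<beta>] unfolding mem_S_carrier by blast
  qed
next
  fix F :: "('n, 'k) RT"
  assume "F \<in> S_carrier s"
  then show "- F \<in> S_carrier s" by (simp add: mem_S_carrier in_keys_iff)
qed (auto simp: mem_S_carrier)

lemma ring_S_ring: "ring (S_ring s)"
  by (subst S_ring_eq) (rule ring_ring_on[OF subring_set_S])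

lemma
  fixes F G :: "('n, 'k::field) RT"
  shows S_add: "F \<in> S_carrier s \<Longrightarrow> G \<in> S_carrier s \<Longrightarrow> F + G \<in> S_carrier s"
  and S_mult: "F \<in> S_carrier s \<Longrightarrow> G \<in> S_carrier s \<Longrightarrow> F * G \<in> S_carrier s"
  and S_uminus: "F \<in> S_carrier s \<Longrightarrow> - F \<in> S_carrier s"
  and S_zero: "(0 :: ('n, 'k) RT) \<in> S_carrier s"
  and S_one: "(1 :: ('n, 'k) RT) \<in> S_carrier s"
  using subring_set_S[of s, where 'n = 'n and 'k = 'k] unfolding subring_set_def by blast+

lemma mono_term_in_S: "Poly_Mapping.keys \<alpha> \<subseteq> {1..s} \<Longrightarrow> mono_term m \<alpha> c \<in> S_carrier s"
  by (auto simp: mem_S_carrier split: if_splits)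

lemma rees_ideal_eq: "rees_ideal I s f = {F \<in> S_carrier s. rees_map f F = 0}"
  by (simp add: rees_ideal_def a_kernel_def' rees_algebra_def)

lemma ideal_S_iff:
  "ideal J (S_ring s) \<longleftrightarrow>
    J \<subseteq> S_carrier s \<and> 0 \<in> J \<and> (\<forall>F\<in>J. \<forall>G\<in>J. F + G \<in> J) \<and> (\<forall>F\<in>S_carrier s. \<forall>G\<in>J. F * G \<in> J)"
  using ideal_ring_on_iff[OF subring_set_S, of J s] unfolding S_ring_eq[symmetric] .

lemma
  assumes "ideal J (S_ring s)"
  shows ideal_S_subset: "J \<subseteq> S_carrier s"
    and ideal_S_zero: "0 \<in> J"
    and ideal_S_add: "F \<in> J \<Longrightarrow> G \<in> J \<Longrightarrow> F + G \<in> J"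
    and ideal_S_mult: "H \<in> S_carrier s \<Longrightarrow> G \<in> J \<Longrightarrow> H * G \<in> J"
  using assms unfolding ideal_S_iff by blast+

lemma ideal_S_diff:
  assumes "ideal J (S_ring s)" and "F \<in> J" and "G \<in> J"
  shows "F - G \<in> J"
proof -
  have "- 1 \<in> S_carrier s" by (intro S_uminus S_one)
  then have "F + - 1 * G \<in> J" using assms by (blast intro: ideal_S_add ideal_S_mult)
  then show ?thesis by simp
qed

text \<open>The ideal \<open>J\<close> serves twice: it bounds the generated ideal from above, and
  it places \<open>G\<close> inside the carrier, as the facts on generated ideals demand.\<close>

lemma genideal_S:
  assumes "ideal J (S_ring s)" and "G \<subseteq> J"
  shows "ideal (Idl\<^bsub>S_ring s\<^esub> G) (S_ring s)" "G \<subseteq> Idl\<^bsub>S_ring s\<^esub> G" "Idl\<^bsub>S_ring s\<^esub> G \<subseteq> J"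
proof -
  have "G \<subseteq> S_carrier s" using assms ideal_S_subset by blast
  then show "ideal (Idl\<^bsub>S_ring s\<^esub> G) (S_ring s)" "G \<subseteq> Idl\<^bsub>S_ring s\<^esub> G"
    by (rule ring.genideal_ideal[OF ring_S_ring], rule ring.genideal_self[OF ring_S_ring])
  show "Idl\<^bsub>S_ring s\<^esub> G \<subseteq> J" by (rule ring.genideal_minimal[OF ring_S_ring assms])
qed

lemma ideal_rees_ideal: "ideal (rees_ideal I s f) (S_ring s)"
  unfolding ideal_S_iff rees_ideal_eq
  by (simp add: rees_map_add rees_map_mult subset_eq S_add S_mult S_zero)


section \<open>Binomials of the defining ideal\<close>

text \<open>A relation has, next to each of its terms, a second term with the same image; subtracting a
  binomial relation removes the first one.\<close>

lemma rees_ideal_subset_if_binomials: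
  fixes Q :: "('n, 'k::field) RT set"
  assumes Q: "ideal Q (S_ring s)"
    and binomial: "\<And>m \<alpha> m' \<beta>. Poly_Mapping.keys \<alpha> \<subseteq> {1..s} \<Longrightarrow> Poly_Mapping.keys \<beta> \<subseteq> {1..s} \<Longrightarrow>
      mdeg \<alpha> = mdeg \<beta> \<Longrightarrow> m + mon_power f \<alpha> = m' + mon_power f \<beta> \<Longrightarrow>
      mono_term m \<alpha> 1 - mono_term m' \<beta> 1 \<in> Q"
  shows "rees_ideal I s f \<subseteq> Q"
proof
  fix F :: "('n, 'k) RT"
  assume "F \<in> rees_ideal I s f"
  then show "F \<in> Q"
  proof (induction "card (poly_terms F)" arbitrary: F rule: less_induct)
    case less
    have FS: "F \<in> S_carrier s" and F0: "rees_map f F = 0"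
      using less.prems by (auto simp: rees_ideal_eq)
    show ?case
    proof (cases "poly_terms F = {}")
      case True
      then show ?thesis using sum_mono_terms[of F] ideal_S_zero[OF Q] by simp
    next
      case False
      then obtain \<alpha> m where am: "(\<alpha>, m) \<in> poly_terms F" by auto
      define c where "c = coefficient (coefficient F \<alpha>) m"
      let ?w = "m + mon_power f \<alpha>"
      let ?t = "\<lambda>(\<beta>, m'). if mdeg \<beta> = mdeg \<alpha> \<and> m' + mon_power f \<beta> = ?w
        then coefficient (coefficient F \<beta>) m' else 0"
      \<comment> \<open>A vanishing sum with a nonzero summand at \<open>(\<alpha>, m)\<close> must
        have a second nonzero summand; it supplies the partner term
        \<open>(\<beta>, m')\<close>.\<close>
      have "(\<Sum>x\<in>poly_terms F. ?t x) = 0"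
        using coeff_rees_map[of f F "mdeg \<alpha>" ?w] F0 by simp
      moreover have "?t (\<alpha>, m) \<noteq> 0" using am by (simp add: in_keys_iff)
      ultimately have "(\<Sum>x\<in>poly_terms F - {(\<alpha>, m)}. ?t x) \<noteq> 0"
        using am by (subst (asm) sum.remove[OF finite_poly_terms am]) auto
      then obtain x where x: "x \<in> poly_terms F - {(\<alpha>, m)}" and tx: "?t x \<noteq> 0"
        by (meson sum.neutral)
      then obtain \<beta> m' where bm: "(\<beta>, m') \<in> poly_terms F" "(\<beta>, m') \<noteq> (\<alpha>, m)"
        and eq: "mdeg \<alpha> = mdeg \<beta>" "?w = m' + mon_power f \<beta>"
        by (cases x) (auto split: if_splits)
      have keys: "Poly_Mapping.keys \<alpha> \<subseteq> {1..s}" "Poly_Mapping.keys \<beta> \<subseteq> {1..s}"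
        using FS am bm unfolding mem_S_carrier by blast+
      define B where "B = mono_term m \<alpha> c - mono_term m' \<beta> c"
      have B_eq: "B = mono_term 0 0 c * (mono_term m \<alpha> 1 - mono_term m' \<beta> 1)"
        by (simp add: B_def right_diff_distrib mult_single)
      have BQ: "B \<in> Q"
        unfolding B_eq by (intro ideal_S_mult[OF Q] binomial[OF keys eq] mono_term_in_S) simp
      have BK: "B \<in> rees_ideal I s f"
        using ideal_S_subset[OF Q] BQ eq
        by (auto simp: rees_ideal_eq rees_map_diff rees_map_mono_term B_def)
      \<comment> \<open>The coefficient \<open>c\<close> is chosen to cancel the term at
        \<open>(\<alpha>, m)\<close>. The only other term touched sits at
        \<open>(\<beta>, m')\<close>, already in the support, so no new term appears.\<close>
      have "poly_terms (F - B) \<subseteq> poly_terms F - {(\<alpha>, m)}"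
      proof
        fix y assume "y \<in> poly_terms (F - B)"
        then obtain \<gamma> l where y: "y = (\<gamma>, l)" "coefficient (coefficient (F - B) \<gamma>) l \<noteq> 0"
          by (cases y) (auto simp: in_keys_iff)
        have "coefficient (coefficient (F - B) \<gamma>) l = coefficient (coefficient F \<gamma>) l
            - (if (\<gamma>, l) = (\<alpha>, m) then c else 0) + (if (\<gamma>, l) = (\<beta>, m') then c else 0)"
          by (simp add: B_def lookup_minus lookup_single when_def)
        with y bm am show "y \<in> poly_terms F - {(\<alpha>, m)}"
          unfolding y mem_poly_terms Diff_iff by (auto simp: c_def split: if_splits)
      qed
      then have "card (poly_terms (F - B)) < card (poly_terms F)"
        using am by (intro psubset_card_mono finite_poly_terms) blast
      moreover have "F - B \<in> rees_ideal I s f"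
        by (rule ideal_S_diff[OF ideal_rees_ideal less.prems BK])
      ultimately have "F - B \<in> Q" by (rule less.hyps)
      then have "(F - B) + B \<in> Q" using BQ by (rule ideal_S_add[OF Q])
      then show ?thesis by simp
    qed
  qed
qed

text \<open>The l1 distance of exponent vectors: subtraction truncates, so at most one of the two
  differences is nonzero and their sum is the absolute value.\<close>

definition mon_dist :: "'n::finite mon \<Rightarrow> 'n mon \<Rightarrow> nat" where
  "mon_dist p q = (\<Sum>i\<in>UNIV. (exponent p i - exponent q i) + (exponent q i - exponent p i))"

lemma mon_dist_commute: "mon_dist p q = mon_dist q p"
  by (simp add: mon_dist_def add.commute)

text \<open>Only the coordinates \<open>i\<close> and \<open>j\<close> change, and each moves one
  unit towards \<open>q\<close> without passing it. The equation with \<open>var j\<close> on the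
  left avoids truncated subtraction.\<close>

lemma mon_dist_exchange_less:
  assumes "p' + var j = p + var i" and "exponent p i < exponent q i" and "exponent q j < exponent p j"
  shows "mon_dist p' q < mon_dist p q"
proof -
  have "i \<noteq> j" using assms by auto
  have e: "exponent p' k + (if j = k then 1 else 0) = exponent p k + (if i = k then 1 else 0)" for k
    using arg_cong[OF assms(1), of "\<lambda>m. exponent m k"] by (simp add: lookup_add exponent_var)
  show ?thesis
    unfolding mon_dist_def
  proof (rule sum_strict_mono_ex1)
    show "\<forall>k\<in>UNIV. (exponent p' k - exponent q k) + (exponent q k - exponent p' k)
        \<le> (exponent p k - exponent q k) + (exponent q k - exponent p k)"
    proof
      fix k
      show "(exponent p' k - exponent q k) + (exponent q k - exponent p' k)
        \<le> (exponent p k - exponent q k) + (exponent q k - exponent p k)"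
        using e[of k] assms(2,3) \<open>i \<noteq> j\<close> by (cases "k = i"; cases "k = j") auto
    qed
    show "\<exists>k\<in>UNIV. (exponent p' k - exponent q k) + (exponent q k - exponent p' k)
        < (exponent p k - exponent q k) + (exponent q k - exponent p k)"
      using e[of i] assms(2,3) \<open>i \<noteq> j\<close> by (intro bexI[of _ i]) auto
  qed simp
qed

text \<open>What the binomial argument uses of a symmetric strongly shifted ideal: generators of one
  degree and an exchange for arbitrary \<open>i\<close> and \<open>j\<close>, with no order on the
  variables.\<close>

locale exchange_generators =
  fixes f :: "nat \<Rightarrow> 'n::finite mon" and s d :: nat
  assumes mdeg_gen: "a \<in> {1..s} \<Longrightarrow> mdeg (f a) = d"
    and exchange: "a \<in> {1..s} \<Longrightarrow> exponent (f a) i < exponent (f a) j \<Longrightarrow>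
      \<exists>b\<in>{1..s}. f b + var j = f a + var i"
begin

text \<open>The linear relation between \<open>T_a\<close> and \<open>T_b\<close> is multiplied by
  the rest of the term: a variable \<open>x_i\<close> of the coefficient is traded for
  \<open>x_j\<close> while the factor \<open>f a\<close> becomes \<open>f b\<close>, and the image
  stays the same.\<close>

lemma mono_term_move:
  fixes Q :: "('n, 'k::field) RT set"
  assumes Q: "ideal Q (S_ring s)"
    and lin: "\<forall>a\<in>{1..s}. \<forall>b\<in>{1..s}. \<forall>i j. f b + var j = f a + var i \<longrightarrow>
      mono_term (var i) (var a) 1 - mono_term (var j) (var b) 1 \<in> Q"
    and keys: "Poly_Mapping.keys \<alpha> \<subseteq> {1..s}"
    and a: "a \<in> Poly_Mapping.keys \<alpha>" and less: "exponent (f a) i < exponent (f a) j"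
    and i: "0 < exponent m i"
  obtains m' \<alpha>' where "Poly_Mapping.keys \<alpha>' \<subseteq> {1..s}" "mdeg \<alpha>' = mdeg \<alpha>"
    "m' + mon_power f \<alpha>' = m + mon_power f \<alpha>"
    "mon_power f \<alpha>' + var j = mon_power f \<alpha> + var i"
    "mono_term m \<alpha> 1 - mono_term m' \<alpha>' 1 \<in> Q"
proof -
  obtain m0 where m: "m = m0 + var i" using i by (rule mon_split_var)
  obtain \<alpha>0 where \<alpha>: "\<alpha> = \<alpha>0 + var a" using a mon_split_var[of \<alpha> a] by (auto simp: in_keys_iff)
  have keys0: "Poly_Mapping.keys \<alpha>0 \<subseteq> {1..s}"
    using keys by (auto simp: \<alpha> in_keys_iff lookup_add)
  have "a \<in> {1..s}" using a keys by auto
  then obtain b where b: "b \<in> {1..s}" "f b + var j = f a + var i"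
    using exchange less by blast
  have "mono_term m \<alpha> 1 - mono_term (m0 + var j) (\<alpha>0 + var b) 1
      = mono_term m0 \<alpha>0 1 * (mono_term (var i) (var a) 1 - mono_term (var j) (var b) (1::'k))"
    by (simp add: m \<alpha> right_diff_distrib mult_single)
  moreover have "\<dots> \<in> Q"
    by (intro ideal_S_mult[OF Q] lin[rule_format, OF \<open>a \<in> {1..s}\<close> b] mono_term_in_S[OF keys0])
  ultimately have "mono_term m \<alpha> 1 - mono_term (m0 + var j) (\<alpha>0 + var b) (1::'k) \<in> Q" by simp
  moreover have "Poly_Mapping.keys (\<alpha>0 + var b) \<subseteq> {1..s}"
    using keys_add[of \<alpha>0 "var b"] keys0 b(1) by (auto split: if_splits)
  moreover have "mdeg (\<alpha>0 + var b) = mdeg \<alpha>" by (simp add: \<alpha> mdeg_add)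
  moreover have power: "mon_power f (\<alpha>0 + var b) + var j = mon_power f \<alpha> + var i"
    using b(2) by (simp add: \<alpha> mon_power_add add.assoc)
  moreover have "(m0 + var j) + mon_power f (\<alpha>0 + var b) = m + mon_power f \<alpha>"
    unfolding m using arg_cong[OF power, of "\<lambda>p. m0 + p"] by (simp only: add_ac)
  ultimately show thesis using that by blast
qed

text \<open>Let \<open>p = f\<^sup>\<alpha>\<close> and \<open>q = f\<^sup>\<beta>\<close>. If \<open>p \<noteq> q\<close>, then \<open>p\<^sub>i < q\<^sub>i\<close> and \<open>q\<^sub>j < p\<^sub>j\<close> for some \<open>i\<close>, \<open>j\<close>.
  Either some factor \<open>u\<close> of \<open>p\<close> has \<open>u\<^sub>i < u\<^sub>j\<close>, or some factor \<open>v\<close> of \<open>q\<close> has \<open>v\<^sub>j < v\<^sub>i\<close>, because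
  otherwise \<open>p\<^sub>j \<le> p\<^sub>i < q\<^sub>i \<le> q\<^sub>j\<close>. The exchange in that factor reduces the distance of \<open>p\<close> and \<open>q\<close>.\<close>

lemma binomial_in_ideal:
  fixes Q :: "('n, 'k::field) RT set"
  assumes Q: "ideal Q (S_ring s)"
    and lin: "\<forall>a\<in>{1..s}. \<forall>b\<in>{1..s}. \<forall>i j. f b + var j = f a + var i \<longrightarrow>
      mono_term (var i) (var a) 1 - mono_term (var j) (var b) 1 \<in> Q"
    and fib: "\<And>\<alpha> \<beta>. Poly_Mapping.keys \<alpha> \<subseteq> {1..s} \<Longrightarrow> Poly_Mapping.keys \<beta> \<subseteq> {1..s} \<Longrightarrow>
      mdeg \<alpha> = mdeg \<beta> \<Longrightarrow> mon_power f \<alpha> = mon_power f \<beta> \<Longrightarrow>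
      mono_term 0 \<alpha> 1 - mono_term 0 \<beta> 1 \<in> Q"
    and "Poly_Mapping.keys \<alpha> \<subseteq> {1..s}" "Poly_Mapping.keys \<beta> \<subseteq> {1..s}"
    and "mdeg \<alpha> = mdeg \<beta>" "m + mon_power f \<alpha> = m' + mon_power f \<beta>"
  shows "mono_term m \<alpha> 1 - mono_term m' \<beta> 1 \<in> Q"
  using assms(4-)
proof (induction "mon_dist (mon_power f \<alpha>) (mon_power f \<beta>)" arbitrary: m \<alpha> m' \<beta> rule: less_induct)
  case less
  let ?p = "mon_power f \<alpha>" and ?q = "mon_power f \<beta>"
  show ?case
  proof (cases "?p = ?q")
    case True
    \<comment> \<open>Cancelling the equal products gives \<open>m = m'\<close>, so the binomial is
      a monomial multiple of a pure relation in the \<open>T\<close> variables.\<close>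
    then have "mono_term m \<alpha> 1 - mono_term m' \<beta> (1::'k)
        = mono_term m 0 1 * (mono_term 0 \<alpha> 1 - mono_term 0 \<beta> 1)"
      using less.prems(4) by (simp add: right_diff_distrib mult_single)
    also have "\<dots> \<in> Q"
      by (intro ideal_S_mult[OF Q] fib[OF less.prems(1-3) True] mono_term_in_S) simp
    finally show ?thesis .
  next
    case False
    \<comment> \<open>Equal degree together with \<open>?p \<noteq> ?q\<close> yields a coordinate
      where \<open>?p\<close> is smaller and another where \<open>?q\<close> is smaller.\<close>
    have "mdeg ?p = mdeg ?q"
      using less.prems(1-3) mdeg_gen by (subst (1 2) mdeg_mon_power[of _ f d]) auto
    then obtain i j where i: "exponent ?p i < exponent ?q i" and j: "exponent ?q j < exponent ?p j"
      using False by (metis mon_mdeg_eq_obtain_less)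
    have exps: "exponent m k + exponent ?p k = exponent m' k + exponent ?q k" for k
      using less.prems(4) by (metis lookup_add)
    consider a where "a \<in> Poly_Mapping.keys \<alpha>" "exponent (f a) i < exponent (f a) j"
      | b where "b \<in> Poly_Mapping.keys \<beta>" "exponent (f b) j < exponent (f b) i"
    proof (rule ccontr)
      assume none: "\<not> thesis"
      have "exponent ?p j \<le> exponent ?p i"
        unfolding exponent_mon_power using none that(1) by (intro sum_mono mult_le_mono2) (meson not_le)
      moreover have "exponent ?q i \<le> exponent ?q j"
        unfolding exponent_mon_power using none that(2) by (intro sum_mono mult_le_mono2) (meson not_le)
      ultimately show False using i j by simp
    qed
    then show ?thesis
    proof cases
      case 1
      \<comment> \<open>The total images agree while \<open>?q\<close> has more of
        \<open>x_i\<close> than \<open>?p\<close>, so the coefficient \<open>m\<close> must contain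
        the \<open>x_i\<close> that the exchange consumes.\<close>
      have "0 < exponent m i" using exps[of i] i by simp
      then obtain m1 \<alpha>1 where new: "Poly_Mapping.keys \<alpha>1 \<subseteq> {1..s}" "mdeg \<alpha>1 = mdeg \<alpha>"
        "m1 + mon_power f \<alpha>1 = m + ?p" "mon_power f \<alpha>1 + var j = ?p + var i"
        "mono_term m \<alpha> 1 - mono_term m1 \<alpha>1 1 \<in> Q"
        by (rule mono_term_move[OF Q lin less.prems(1) 1])
      have "mono_term m1 \<alpha>1 1 - mono_term m' \<beta> 1 \<in> Q"
        using less.prems new by (intro less.hyps mon_dist_exchange_less[OF new(4) i j]) auto
      then have "(mono_term m \<alpha> 1 - mono_term m1 \<alpha>1 1) + (mono_term m1 \<alpha>1 1 - mono_term m' \<beta> 1) \<in> Q"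
        using new(5) by (rule ideal_S_add[OF Q, rotated])
      then show ?thesis by simp
    next
      case 2
      have "0 < exponent m' j" using exps[of j] j by simp
      then obtain m1 \<beta>1 where new: "Poly_Mapping.keys \<beta>1 \<subseteq> {1..s}" "mdeg \<beta>1 = mdeg \<beta>"
        "m1 + mon_power f \<beta>1 = m' + ?q" "mon_power f \<beta>1 + var i = ?q + var j"
        "mono_term m' \<beta> 1 - mono_term m1 \<beta>1 1 \<in> Q"
        by (rule mono_term_move[OF Q lin less.prems(2) 2])
      \<comment> \<open>Here the exchange moves \<open>?q\<close> towards \<open>?p\<close>, with
        the roles of \<open>i\<close> and \<open>j\<close> swapped.\<close>
      have "mon_dist ?p (mon_power f \<beta>1) < mon_dist ?p ?q"
        using mon_dist_exchange_less[OF new(4) j i] by (simp add: mon_dist_commute)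
      then have "mono_term m \<alpha> 1 - mono_term m1 \<beta>1 1 \<in> Q"
        using less.prems new by (intro less.hyps) auto
      then have "(mono_term m \<alpha> 1 - mono_term m1 \<beta>1 1) - (mono_term m' \<beta> 1 - mono_term m1 \<beta>1 1) \<in> Q"
        using new(5) by (rule ideal_S_diff[OF Q])
      then show ?thesis by simp
    qed
  qed
qed

text \<open>The common core of both claims of the theorem: it is applied once with \<open>Q\<close>
  the sum of the linear part and the extended fiber ideal, and once with \<open>Q\<close> generated
  by the relations of the allowed bidegrees.\<close>

lemma rees_ideal_subset:
  fixes Q :: "('n, 'k::field) RT set"
  assumes Q: "ideal Q (S_ring s)"
    and lin: "\<And>i j a b. mono_term (var i) (var a) 1 - mono_term (var j) (var b) 1 \<in> rees_ideal I s f \<Longrightarrow>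
      mono_term (var i) (var a) 1 - mono_term (var j) (var b) 1 \<in> Q"
    and fib: "\<And>\<alpha> \<beta>. mdeg \<alpha> = mdeg \<beta> \<Longrightarrow> mono_term 0 \<alpha> 1 - mono_term 0 \<beta> 1 \<in> rees_ideal I s f \<Longrightarrow>
      mono_term 0 \<alpha> 1 - mono_term 0 \<beta> 1 \<in> Q"
  shows "rees_ideal I s f \<subseteq> Q"
proof (rule rees_ideal_subset_if_binomials[OF Q], rule binomial_in_ideal[OF Q])
  have K: "mono_term m \<alpha> 1 - mono_term m' \<beta> 1 \<in> rees_ideal I s f"
    if "Poly_Mapping.keys \<alpha> \<subseteq> {1..s}" "Poly_Mapping.keys \<beta> \<subseteq> {1..s}" "mdeg \<alpha> = mdeg \<beta>"
      "m + mon_power f \<alpha> = m' + mon_power f \<beta>" for m m' \<alpha> \<beta>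
  proof -
    have "mono_term m \<alpha> 1 - mono_term m' \<beta> (1::'k) \<in> S_carrier s"
      unfolding diff_conv_add_uminus using that by (intro S_add S_uminus mono_term_in_S)
    then show ?thesis using that by (simp add: rees_ideal_eq rees_map_diff rees_map_mono_term)
  qed
  show "\<forall>a\<in>{1..s}. \<forall>b\<in>{1..s}. \<forall>i j. f b + var j = f a + var i \<longrightarrow>
      mono_term (var i) (var a) 1 - mono_term (var j) (var b) 1 \<in> Q"
    by (intro ballI allI impI lin K) (auto simp: add.commute)
  show "mono_term 0 \<alpha> 1 - mono_term 0 \<beta> 1 \<in> Q"
    if "Poly_Mapping.keys \<alpha> \<subseteq> {1..s}" "Poly_Mapping.keys \<beta> \<subseteq> {1..s}" "mdeg \<alpha> = mdeg \<beta>"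
      "mon_power f \<alpha> = mon_power f \<beta>" for \<alpha> \<beta>
    using that by (intro fib K) auto
qed

end


section \<open>Generators of symmetric strongly shifted ideals\<close>

lemma ring_R_ring: "ring R_ring"
  by (rule ring_ring_on[OF subring_set_UNIV])

lemma ideal_R_iff:
  "ideal J R_ring \<longleftrightarrow> 0 \<in> J \<and> (\<forall>a\<in>J. \<forall>b\<in>J. a + b \<in> J) \<and> (\<forall>a. \<forall>b\<in>J. a * b \<in> J)"
  by (simp add: ideal_ring_on_iff[OF subring_set_UNIV])

text \<open>The polynomials all of whose monomials are divisible by a member of \<open>M\<close>
  form an ideal containing the generators, hence containing the ideal they generate.\<close>

lemma keys_genideal_monomials:
  assumes "p \<in> Idl\<^bsub>R_ring\<^esub> (xpow ` M)" and "m \<in> Poly_Mapping.keys p"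
  obtains g h where "g \<in> M" "m = h + g"
proof -
  let ?J = "{p :: ('a, 'b) R. \<forall>m\<in>Poly_Mapping.keys p. \<exists>g\<in>M. \<exists>h. m = h + g}"
  have "ideal ?J R_ring"
    unfolding ideal_R_iff
  proof (intro conjI ballI allI)
    fix a b assume "a \<in> ?J" "b \<in> ?J"
    then show "a + b \<in> ?J" using keys_add[of a b] by blast
  next
    fix a b assume b: "b \<in> ?J"
    show "a * b \<in> ?J"
    proof (rule CollectI, rule ballI)
      fix m assume "m \<in> Poly_Mapping.keys (a * b)"
      then obtain k l where "l \<in> Poly_Mapping.keys b" "m = k + l" using keys_mult[of a b] by blast
      moreover from this obtain g h where "g \<in> M" "l = h + g" using b by blast
      ultimately show "\<exists>g\<in>M. \<exists>h. m = h + g" by (metis add.assoc)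
    qed
  qed simp
  moreover have "xpow ` M \<subseteq> ?J"
    by (auto intro!: exI[of _ 0])
  ultimately have "Idl\<^bsub>R_ring\<^esub> (xpow ` M) \<subseteq> ?J"
    by (rule ring.genideal_minimal[OF ring_R_ring])
  then show thesis using assms that by blast
qed

text \<open>The k-th index in the order of the type is sent to the k-th index after sorting by
  \<open>u\<close>; \<open>idx\<close> recovers the position k of an index.\<close>

lemma ex_bij_mono_comp:
  fixes u :: "'n::{finite, linorder} \<Rightarrow> nat"
  obtains \<tau> :: "'n \<Rightarrow> 'n" where "bij \<tau>" "mono (u \<circ> \<tau>)"
proof -
  define xs where "xs = sorted_list_of_set (UNIV :: 'n set)"
  define ys where "ys = sort_key u xs"
  have xs: "distinct xs" "set xs = UNIV" "sorted xs" by (simp_all add: xs_def)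
  have ys: "distinct ys" "set ys = UNIV" "sorted (map u ys)" "length ys = length xs"
    using xs by (simp_all add: ys_def)
  have bij_xs: "bij_betw ((!) xs) {..<length xs} UNIV" using xs bij_betw_nth[of xs "{..<length xs}" UNIV] by simp
  have bij_ys: "bij_betw ((!) ys) {..<length xs} UNIV" using ys bij_betw_nth[of ys "{..<length ys}" UNIV] by simp
  define idx where "idx = inv_into {..<length xs} ((!) xs)"
  have bidx: "bij_betw idx UNIV {..<length xs}"
    unfolding idx_def using bij_xs by (rule bij_betw_inv_into)
  have nth_idx: "xs ! idx x = x" and idx_less: "idx x < length xs" for x
    using bij_xs bidx by (auto simp: idx_def bij_betw_inv_into_right bij_betw_def)
  have idx_mono: "idx x \<le> idx y" if "x \<le> y" for x y
  proof (rule ccontr)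
    assume "\<not> idx x \<le> idx y"
    then have "y \<le> x" using sorted_nth_mono[OF xs(3), of "idx y" "idx x"] nth_idx idx_less by simp
    with that \<open>\<not> idx x \<le> idx y\<close> show False by simp
  qed
  show thesis
  proof
    show "bij ((!) ys \<circ> idx)" using bidx bij_ys by (rule bij_betw_trans)
    show "mono (u \<circ> ((!) ys \<circ> idx))"
    proof
      fix x y :: 'n assume "x \<le> y"
      then show "(u \<circ> ((!) ys \<circ> idx)) x \<le> (u \<circ> ((!) ys \<circ> idx)) y"
        using sorted_nth_mono[OF ys(3), of "idx x" "idx y"] idx_mono idx_less[of y] idx_less[of x] ys(4) by simp
    qed
  qed
qed

section \<open>Permuting variables, and exchanges at arbitrary positions\<close>

lemma exponent_perm_mon: "bij \<sigma> \<Longrightarrow> exponent (perm_mon \<sigma> m) i = exponent m (inv_into UNIV \<sigma> i)"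
  unfolding perm_mon_def by (simp add: map_key.rep_eq bij_is_inj bij_imp_bij_inv)

lemma perm_act_xpow: "perm_act \<sigma> (xpow m) = xpow (perm_mon \<sigma> m)"
  by (simp add: perm_act_def xpow_def)

lemma sym_fixed_perm_mon:
  assumes "sym_fixed I" and "bij \<sigma>" and "xpow m \<in> I"
  shows "xpow (perm_mon \<sigma> m) \<in> I"
  using assms unfolding sym_fixed_def by (metis imageI perm_act_xpow)

text \<open>A permutation of the variables sorts the exponents of \<open>u\<close> into a partition.
  There \<open>i\<close> stands before \<open>j\<close> because its exponent is smaller, so the
  shift condition applies, and the result is carried back by the inverse permutation.\<close>

lemma strongly_shifted_exchange:
  fixes u :: "'n::{finite, linorder} mon"
  assumes I: "symmetric_strongly_shifted I" and u: "xpow u \<in> I" and less: "exponent u i < exponent u j"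
  shows "xpow (u + var i - var j) \<in> I"
proof -
  obtain \<tau> :: "'n \<Rightarrow> 'n" where \<tau>: "bij \<tau>" "mono (exponent u \<circ> \<tau>)" by (rule ex_bij_mono_comp)
  \<comment> \<open>The action composes exponents with the inverse, so it is the inverse of
    \<open>\<tau>\<close> that produces the sorted vector
    \<open>exponent u \<circ> \<tau>\<close>.\<close>
  define \<sigma> where "\<sigma> = inv_into UNIV \<tau>"
  have \<sigma>: "bij \<sigma>" "inv_into UNIV \<sigma> = \<tau>" using \<tau>(1) by (simp_all add: \<sigma>_def bij_imp_bij_inv inv_inv_eq)
  have \<tau>\<sigma>: "\<tau> (\<sigma> k) = k" for k using \<tau>(1) by (simp add: \<sigma>_def bij_is_surj surj_f_inv_f)
  have sym: "sym_fixed I" using I by (simp add: symmetric_strongly_shifted_def)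
  define l where "l = perm_mon \<sigma> u"
  have l: "exponent l k = exponent u (\<tau> k)" for k by (simp add: l_def exponent_perm_mon \<sigma>)
  have "l \<in> partitions_of I"
    using \<tau>(2) sym_fixed_perm_mon[OF sym \<sigma>(1) u] l
    by (simp add: partitions_of_def partitions_def l_def mono_def)
  moreover have l_less: "exponent l (\<sigma> i) < exponent l (\<sigma> j)" using less by (simp add: l \<tau>\<sigma>)
  moreover have "\<sigma> i < \<sigma> j"
  proof (rule ccontr)
    assume "\<not> \<sigma> i < \<sigma> j"
    then have "exponent l (\<sigma> j) \<le> exponent l (\<sigma> i)"
      using monoD[OF \<tau>(2), of "\<sigma> j" "\<sigma> i"] by (simp add: l)
    then show False using l_less by simp
  qed
  ultimately have "xpow (l + var (\<sigma> i) - var (\<sigma> j)) \<in> I"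
    using I by (simp add: symmetric_strongly_shifted_def)
  then have "xpow (perm_mon \<tau> (l + var (\<sigma> i) - var (\<sigma> j))) \<in> I"
    by (rule sym_fixed_perm_mon[OF sym \<tau>(1)])
  moreover have "perm_mon \<tau> (l + var (\<sigma> i) - var (\<sigma> j)) = u + var i - var j"
  proof (rule poly_mapping_eqI)
    fix k
    have "\<sigma> x = \<sigma> y \<longleftrightarrow> x = y" for x y using \<tau>\<sigma> by metis
    then show "exponent (perm_mon \<tau> (l + var (\<sigma> i) - var (\<sigma> j))) k = exponent (u + var i - var j) k"
      by (simp add: exponent_perm_mon[OF \<tau>(1)] \<sigma>_def[symmetric] l \<tau>\<sigma> lookup_add lookup_minus exponent_var)
  qed
  ultimately show ?thesis by simp
qed

text \<open>The exchanged monomial lies in \<open>I\<close>, so some generator divides it; both have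
  degree \<open>d\<close>, so they coincide.\<close>

lemma exchange_generators_if_strongly_shifted:
  assumes I: "symmetric_strongly_shifted I" and gens: "Idl\<^bsub>R_ring\<^esub> (xpow ` f ` {1..s}) = I"
    and deg: "\<forall>i\<in>{1..s}. mdeg (f i) = d"
  shows "exchange_generators f s d"
proof
  show "mdeg (f a) = d" if "a \<in> {1..s}" for a using deg that by blast
next
  fix a i j assume a: "a \<in> {1..s}" and less: "exponent (f a) i < exponent (f a) j"
  have "xpow (f a) \<in> I"
    using a ring.genideal_self[OF ring_R_ring, of "xpow ` f ` {1..s}"] unfolding gens[symmetric] by auto
  then have "xpow (f a + var i - var j) \<in> I"
    by (rule strongly_shifted_exchange[OF I _ less])
  then obtain g h where g: "g \<in> f ` {1..s}" "f a + var i - var j = h + g"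
    unfolding gens[symmetric] by (rule keys_genideal_monomials) simp_all
  then obtain b where b: "b \<in> {1..s}" "f a + var i - var j = h + f b" by blast
  have eq: "f a + var i - var j + var j = f a + var i"
    using less by (intro poly_mapping_eqI) (auto simp: lookup_add lookup_minus exponent_var)
  have "mdeg (f a + var i - var j + var j) = mdeg (f a + var i)" by (simp only: eq)
  then have "mdeg (f a + var i - var j) = mdeg (f a)" unfolding mdeg_add mdeg_single by simp
  then have "f a + var i - var j = f b"
    using mon_dvd_mdeg_eq[OF b(2)] deg a b(1) by simp
  then show "\<exists>b\<in>{1..s}. f b + var j = f a + var i" using eq b(1) by auto
qed


section \<open>The fiber ideal\<close>

lemma ideal_ideal_power:
  assumes "ideal I R_ring"
  shows "ideal (ideal_power I k) R_ring"
proof (induction k)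
  case 0
  then show ?case by (simp add: ideal_R_iff)
next
  case (Suc k)
  then show ?case using ring.ideal_prod_is_ideal[OF ring_R_ring assms] by simp
qed

text \<open>On a generator \<open>x * y\<close> of the product of \<open>I\<close> with its k-th
  power, multiplication by \<open>b\<close> is regrouped as \<open>x * (y * b)\<close>, and the
  induction hypothesis places \<open>y * b\<close>.\<close>

lemma ideal_power_mult:
  assumes I: "ideal I R_ring" and "a \<in> ideal_power I k" and b: "b \<in> ideal_power I l"
  shows "a * b \<in> ideal_power I (k + l)"
  using assms(2)
proof (induction k arbitrary: a)
  case 0
  then show ?case using ideal_ideal_power[OF I, of l] b by (simp add: ideal_R_iff)
next
  case (Suc k)
  from Suc.prems have "a \<in> I \<cdot>\<^bsub>R_ring\<^esub> ideal_power I k" by simp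
  then show ?case
  proof (induction a rule: ideal_prod.induct)
    case (prod x y)
    then have "x * (y * b) \<in> I \<cdot>\<^bsub>R_ring\<^esub> ideal_power I (k + l)"
      using ideal_prod.prod[of x I "y * b" "ideal_power I (k + l)" R_ring] Suc.IH by simp
    then show ?case by (simp add: mult.assoc)
  next
    case (sum x y)
    then show ?case
      using ideal_prod.sum[of "x * b" R_ring I "ideal_power I (k + l)" "y * b"] by (simp add: distrib_right)
  qed
qed

lemma ideal_power_sum:
  assumes "ideal I R_ring" and "\<And>x. x \<in> A \<Longrightarrow> g x \<in> ideal_power I k"
  shows "sum g A \<in> ideal_power I k"
  using assms(2) ideal_ideal_power[OF assms(1), of k]
  by (induction A rule: infinite_finite_induct) (auto simp: ideal_R_iff)

lemma subring_set_rees: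
  assumes I: "ideal I R_ring"
  shows "subring_set {p. \<forall>k. poly.coeff p k \<in> ideal_power I k}"
  unfolding subring_set_def
proof (intro conjI ballI CollectI allI)
  note power = ideal_ideal_power[OF I, unfolded ideal_R_iff]
  show "poly.coeff 0 k \<in> ideal_power I k" for k using power by simp
  show "poly.coeff 1 k \<in> ideal_power I k" for k using power[of k] by (cases k) simp_all
  fix p assume p: "p \<in> {p. \<forall>k. poly.coeff p k \<in> ideal_power I k}"
  have "- 1 * poly.coeff p k \<in> ideal_power I k" for k using power[of k] p by blast
  then show "poly.coeff (- p) k \<in> ideal_power I k" for k by simp
  fix q assume q: "q \<in> {p. \<forall>k. poly.coeff p k \<in> ideal_power I k}"
  show "poly.coeff (p + q) k \<in> ideal_power I k" for k using power[of k] p q by simp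
  show "poly.coeff (p * q) k \<in> ideal_power I k" for k
    unfolding coeff_mult
  proof (rule ideal_power_sum[OF I])
    fix i assume "i \<in> {..k}"
    then show "poly.coeff p i * poly.coeff q (k - i) \<in> ideal_power I k"
      using ideal_power_mult[OF I, of "poly.coeff p i" i "poly.coeff q (k - i)" "k - i"] p q by simp
  qed
qed

section \<open>Degree bounds in powers of the ideal and in the Rees algebra\<close>

lemma mdeg_keys_mult:
  assumes "\<And>m. m \<in> Poly_Mapping.keys p \<Longrightarrow> a \<le> mdeg m" and "\<And>m. m \<in> Poly_Mapping.keys q \<Longrightarrow> b \<le> mdeg m"
    and "m \<in> Poly_Mapping.keys (p * q)"
  shows "a + b \<le> mdeg m"
proof -
  obtain k l where "k \<in> Poly_Mapping.keys p" "l \<in> Poly_Mapping.keys q" "m = k + l"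
    using keys_mult[of p q] assms(3) by blast
  then show ?thesis using assms(1)[of k] assms(2)[of l] by (simp add: mdeg_add)
qed

lemma mdeg_ideal_power:
  assumes "\<And>p m. p \<in> I \<Longrightarrow> m \<in> Poly_Mapping.keys p \<Longrightarrow> d \<le> mdeg m"
    and "p \<in> ideal_power I k" and "m \<in> Poly_Mapping.keys p"
  shows "k * d \<le> mdeg m"
  using assms(2,3)
proof (induction k arbitrary: p m)
  case (Suc k)
  from Suc.prems(1) have "p \<in> I \<cdot>\<^bsub>R_ring\<^esub> ideal_power I k" by simp
  then show ?case using Suc.prems(2)
  proof (induction p arbitrary: m rule: ideal_prod.induct)
    case (prod x y)
    then have "d + k * d \<le> mdeg m"
      using Suc.IH assms(1) by (intro mdeg_keys_mult[of x d y "k * d" m]) auto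
    then show ?case by simp
  next
    case (sum x y)
    then show ?case using keys_add[of x y] by auto
  qed
qed simp

text \<open>The elements of the Rees algebra satisfying this bound form an ideal \<open>?D\<close>.
  It contains the variables, which have \<open>t\<close>-degree 0 and degree
  \<open>1 = 0 * d + 1\<close>.\<close>

lemma mdeg_rees_irrelevant:
  assumes I: "ideal I R_ring" and deg: "\<And>p m. p \<in> I \<Longrightarrow> m \<in> Poly_Mapping.keys p \<Longrightarrow> d \<le> mdeg m"
    and "P \<in> rees_irrelevant I" and "m \<in> Poly_Mapping.keys (poly.coeff P k)"
  shows "k * d < mdeg m"
proof -
  let ?C = "{p. \<forall>k. poly.coeff p k \<in> ideal_power I k}"
  let ?D = "{p \<in> ?C. \<forall>k. \<forall>m\<in>Poly_Mapping.keys (poly.coeff p k). k * d + 1 \<le> mdeg m}"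
  note sub = subring_set_rees[OF I]
  have "ideal ?D (ring_on ?C)"
    unfolding ideal_ring_on_iff[OF sub]
  proof (intro conjI ballI)
    show "0 \<in> ?D" using sub by (auto simp: subring_set_def)
    fix q assume q: "q \<in> ?D"
    show "p + q \<in> ?D" if "p \<in> ?D" for p
    proof (rule CollectI, intro conjI allI ballI)
      show "p + q \<in> ?C" using sub that q unfolding subring_set_def by blast
      show "k * d + 1 \<le> mdeg m" if "m \<in> Poly_Mapping.keys (poly.coeff (p + q) k)" for k m
        using that \<open>p \<in> ?D\<close> q keys_add[of "poly.coeff p k" "poly.coeff q k"] by auto
    qed
    show "p * q \<in> ?D" if p: "p \<in> ?C" for p
    proof (rule CollectI, intro conjI allI ballI)
      show "p * q \<in> ?C" using sub that q unfolding subring_set_def by blast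
      fix k m assume "m \<in> Poly_Mapping.keys (poly.coeff (p * q) k)"
      then have "(\<Sum>i\<le>k. coefficient (poly.coeff p i * poly.coeff q (k - i)) m) \<noteq> 0"
        by (simp add: coeff_mult lookup_sum in_keys_iff)
      then obtain i where "i \<in> {..k}" "coefficient (poly.coeff p i * poly.coeff q (k - i)) m \<noteq> 0"
        by (rule sum.not_neutral_contains_not_neutral)
      then have i: "i \<le> k" "m \<in> Poly_Mapping.keys (poly.coeff p i * poly.coeff q (k - i))"
        by (simp_all add: in_keys_iff)
      \<comment> \<open>The factor from \<open>p\<close> contributes at least \<open>i * d\<close>
        as a member of a power of \<open>I\<close>; the extra 1 comes from \<open>q\<close>
        alone.\<close>
      have "i * d + ((k - i) * d + 1) \<le> mdeg m"
        using p q by (intro mdeg_keys_mult[OF _ _ i(2)]) (auto intro: mdeg_ideal_power[OF deg])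
      moreover have "i * d + (k - i) * d = k * d" using i(1) by (simp flip: distrib_right)
      ultimately show "k * d + 1 \<le> mdeg m" by simp
    qed
  qed auto
  moreover have "[:x:] \<in> ?C" for x
  proof -
    have "poly.coeff [:x:] k \<in> ideal_power I k" for k
      using ideal_ideal_power[OF I, of k] unfolding ideal_R_iff by (cases k) simp_all
    then show ?thesis by blast
  qed
  then have "range (\<lambda>i. [:xpow (Poly_Mapping.single i 1):]) \<subseteq> ?D"
    by (auto simp: coeff_pCons xpow_def split: nat.splits if_splits)
  ultimately have "rees_irrelevant I \<subseteq> ?D"
    unfolding rees_irrelevant_def rees_algebra_def by (rule ring.genideal_minimal[OF ring_ring_on[OF sub]])
  then have "P \<in> ?D" using assms(3) by blast
  then show ?thesis using assms(4) by (simp add: Suc_le_eq)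
qed

text \<open>The generated ideal is an intersection of ideals, each containing zero; over an empty
  family it is everything. So no ring axioms enter.\<close>

lemma zero_in_genideal: "\<zero>\<^bsub>A\<^esub> \<in> Idl\<^bsub>A\<^esub> G"
  unfolding genideal_def by (auto intro: additive_subgroup.zero_closed ideal.axioms(1))

text \<open>The zero of the quotient ring is the irrelevant ideal itself, so lying in the kernel
  means that the coset of the image equals that ideal.\<close>

lemma mem_fiber_ideal:
  "F \<in> fiber_ideal I s f \<longleftrightarrow>
     F \<in> carrier (KT_ring s) \<and> (\<lambda>P. P + rees_map f F) ` rees_irrelevant I = rees_irrelevant I"
  unfolding fiber_ideal_def a_kernel_def' FactRing_def a_r_coset_def' rees_algebra_def
  by (auto simp: image_def)

text \<open>Used in both directions: fiber relations lie in the defining ideal, and binomials in the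
  \<open>T\<close> variables alone count as fiber relations.\<close>

lemma fiber_ideal_eq:
  fixes I :: "('n, 'k::field) R set"
  assumes I: "ideal I R_ring" and deg: "\<And>p m. p \<in> I \<Longrightarrow> m \<in> Poly_Mapping.keys p \<Longrightarrow> d \<le> mdeg m"
    and f: "\<forall>i\<in>{1..s}. mdeg (f i) = d"
  shows "fiber_ideal I s f = carrier (KT_ring s) \<inter> rees_ideal I s f"
proof (rule Set.set_eqI, rule iffI)
  fix F assume "F \<in> carrier (KT_ring s) \<inter> rees_ideal I s f"
  then show "F \<in> fiber_ideal I s f" by (simp add: mem_fiber_ideal rees_ideal_eq)
next
  fix F assume F: "F \<in> fiber_ideal I s f"
  then have FS: "F \<in> S_carrier s" and const: "\<And>\<alpha>. \<exists>c. coefficient F \<alpha> = Poly_Mapping.single 0 c"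
    by (simp_all add: mem_fiber_ideal KT_ring_def)
  have "0 \<in> rees_irrelevant I"
    using zero_in_genideal[of "rees_algebra I"] by (simp add: rees_irrelevant_def rees_algebra_def)
  \<comment> \<open>Translating the zero of the irrelevant ideal by the image gives the image
    itself, and the translate is again the ideal.\<close>
  then have irr: "rees_map f F \<in> rees_irrelevant I" using F unfolding mem_fiber_ideal by force
  have "Poly_Mapping.keys (poly.coeff (rees_map f F) k) = {}" for k
  proof (rule ccontr)
    assume "Poly_Mapping.keys (poly.coeff (rees_map f F) k) \<noteq> {}"
    then obtain w where w: "w \<in> Poly_Mapping.keys (poly.coeff (rees_map f F) k)" by blast
    then obtain x where x: "x \<in> poly_terms F" "(case x of (\<alpha>, m) \<Rightarrow>
        if mdeg \<alpha> = k \<and> m + mon_power f \<alpha> = w then coefficient (coefficient F \<alpha>) m else 0) \<noteq> 0"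
      unfolding in_keys_iff coeff_rees_map by (rule sum.not_neutral_contains_not_neutral)
    obtain \<alpha> m where "x = (\<alpha>, m)" by (cases x)
    with x have am: "(\<alpha>, m) \<in> poly_terms F" "mdeg \<alpha> = k" "m + mon_power f \<alpha> = w"
      by (simp_all split: if_splits)
    \<comment> \<open>Coefficients are scalars, so the whole degree of \<open>w\<close> comes from a
      product of \<open>k\<close> generators.\<close>
    have "m = 0" using am(1) const[of \<alpha>] by (auto split: if_splits)
    moreover have "mdeg (mon_power f \<alpha>) = mdeg \<alpha> * d"
      using FS am(1) f unfolding mem_S_carrier by (intro mdeg_mon_power) blast
    ultimately have "mdeg w = k * d" using am by simp
    then show False using mdeg_rees_irrelevant[OF I deg irr w] by simp
  qed
  then have "rees_map f F = 0" by (intro poly_eqI) (simp add: poly_mapping_eq_iff fun_eq_iff set_eq_iff in_keys_iff)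
  then show "F \<in> carrier (KT_ring s) \<inter> rees_ideal I s f"
    using F FS by (simp add: mem_fiber_ideal rees_ideal_eq)
qed

lemma has_bidegree_binomial:
  assumes "mdeg m = a" "mdeg m' = a" "mdeg \<alpha> = b" "mdeg \<beta> = b"
  shows "has_bidegree (mono_term m \<alpha> c - mono_term m' \<beta> c') a b"
  using assms unfolding has_bidegree_def
  by (auto simp: in_keys_iff lookup_minus lookup_single when_def split: if_splits)

lemma binomial_in_KT:
  fixes c c' :: "'k::field"
  assumes "(mono_term 0 \<alpha> c - mono_term 0 \<beta> c' :: ('n, 'k) RT) \<in> S_carrier s"
  shows "(mono_term 0 \<alpha> c - mono_term 0 \<beta> c' :: ('n, 'k) RT) \<in> carrier (KT_ring s)"
proof -
  have "coefficient (mono_term 0 \<alpha> c - mono_term 0 \<beta> c' :: ('n, 'k) RT) \<gamma>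
      = Poly_Mapping.single 0 ((c when \<alpha> = \<gamma>) - (c' when \<beta> = \<gamma>))" for \<gamma>
    by (simp add: lookup_minus lookup_single when_def single_diff)
  then show ?thesis using assms unfolding KT_ring_def by auto
qed

theorem theorem6p2:
  fixes I :: "('n::{finite, linorder}, 'k::field) R set"
    and s :: nat and f :: "nat \<Rightarrow> 'n mon" and d :: nat
  assumes "symmetric_strongly_shifted I"
    and "min_mon_gens I s f"
    and "\<forall>i\<in>{1..s}. mdeg (f i) = d"
  shows "fiber_type I s f \<and>
    (\<exists>A \<subseteq> rees_ideal I s f.
       (\<forall>F\<in>A. has_bidegree F 1 1 \<or> (\<exists>k. has_bidegree F 0 k)) \<and>
       rees_ideal I s f = Idl\<^bsub>S_ring s\<^esub> A)"
proof -
  let ?K = "rees_ideal I s f" and ?L = "linear_ideal I s f"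
  let ?J = "fiber_ideal I s f" and ?JS = "Idl\<^bsub>S_ring s\<^esub> (fiber_ideal I s f)"
  have gens: "Idl\<^bsub>R_ring\<^esub> (xpow ` f ` {1..s}) = I" using assms(2) by (simp add: min_mon_gens_def)
  interpret exchange_generators f s d
    by (rule exchange_generators_if_strongly_shifted[OF assms(1) gens assms(3)])
  have I: "ideal I R_ring"
    unfolding gens[symmetric] by (intro ring.genideal_ideal ring_R_ring) simp
  have deg: "d \<le> mdeg m" if p: "p \<in> I" and m: "m \<in> Poly_Mapping.keys p" for p m
  proof -
    have "p \<in> Idl\<^bsub>R_ring\<^esub> (xpow ` f ` {1..s})" using p unfolding gens .
    then obtain g h where "g \<in> f ` {1..s}" "m = h + g"
      using m by (rule keys_genideal_monomials)
    then show ?thesis using assms(3) by (auto simp: mdeg_add)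
  qed
  have J_eq: "?J = carrier (KT_ring s) \<inter> ?K"
    by (rule fiber_ideal_eq[OF I _ assms(3)]) (rule deg)
  note K = ideal_rees_ideal[of I s f]
  have KS: "?K \<subseteq> S_carrier s" using ideal_S_subset[OF K] .
  have LK: "{F \<in> ?K. T_linear_form F} \<subseteq> ?K" and JK: "?J \<subseteq> ?K" using J_eq by auto
  have L: "ideal ?L (S_ring s)" "{F \<in> ?K. T_linear_form F} \<subseteq> ?L" "?L \<subseteq> ?K"
    unfolding linear_ideal_def by (rule genideal_S[OF K LK])+
  have JS: "ideal ?JS (S_ring s)" "?J \<subseteq> ?JS" "?JS \<subseteq> ?K"
    by (rule genideal_S[OF K JK])+
  have "?K \<subseteq> ?L <+>\<^bsub>S_ring s\<^esub> ?JS"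
  proof (rule rees_ideal_subset)
    show "ideal (?L <+>\<^bsub>S_ring s\<^esub> ?JS) (S_ring s)" by (rule ring.add_ideals[OF ring_S_ring L(1) JS(1)])
  next
    fix i j :: 'n and a b :: nat
    let ?F = "mono_term (var i) (var a) 1 - mono_term (var j) (var b) 1 :: ('n, 'k) RT"
    assume "?F \<in> ?K"
    moreover have "has_bidegree ?F 1 1" by (rule has_bidegree_binomial) simp_all
    then have "T_linear_form ?F" by (simp add: has_bidegree_def T_linear_form_def)
    ultimately have "?F \<in> ?L" using L(2) by blast
    then have "?F + 0 \<in> ?L <+>\<^bsub>S_ring s\<^esub> ?JS"
      using ideal_S_zero[OF JS(1)] unfolding set_add_def' S_ring_def ring_on_simps by blast
    then show "?F \<in> ?L <+>\<^bsub>S_ring s\<^esub> ?JS" by simp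
  next
    fix \<alpha> \<beta> :: "nat mon"
    let ?F = "mono_term 0 \<alpha> 1 - mono_term 0 \<beta> 1 :: ('n, 'k) RT"
    assume "?F \<in> ?K"
    then have "?F \<in> ?J" using KS by (auto simp only: J_eq intro!: binomial_in_KT)
    then have "?F \<in> ?JS" using JS(2) by blast
    then have "0 + ?F \<in> ?L <+>\<^bsub>S_ring s\<^esub> ?JS"
      using ideal_S_zero[OF L(1)] unfolding set_add_def' S_ring_def ring_on_simps by blast
    then show "?F \<in> ?L <+>\<^bsub>S_ring s\<^esub> ?JS" by simp
  qed
  moreover have "?L <+>\<^bsub>S_ring s\<^esub> ?JS \<subseteq> ?K"
  proof
    fix F assume "F \<in> ?L <+>\<^bsub>S_ring s\<^esub> ?JS"
    then obtain G H where "G \<in> ?L" "H \<in> ?JS" "F = G + H"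
      unfolding set_add_def' by (auto simp: S_ring_def)
    then show "F \<in> ?K" using L(3) JS(3) ideal_S_add[OF K] by blast
  qed
  ultimately have fiber: "fiber_type I s f" unfolding fiber_type_def by blast
  \<comment> \<open>The largest admissible generating set, so that only membership of the two kinds
    of binomials has to be checked.\<close>
  define A where "A = {F \<in> ?K. has_bidegree F 1 1 \<or> (\<exists>k. has_bidegree F 0 k)}"
  have AK: "A \<subseteq> ?K" by (auto simp: A_def)
  have A: "ideal (Idl\<^bsub>S_ring s\<^esub> A) (S_ring s)" "A \<subseteq> Idl\<^bsub>S_ring s\<^esub> A" "Idl\<^bsub>S_ring s\<^esub> A \<subseteq> ?K"
    by (rule genideal_S[OF K AK])+
  have "?K \<subseteq> Idl\<^bsub>S_ring s\<^esub> A"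
  proof (rule rees_ideal_subset[OF A(1)])
    fix i j :: 'n and a b :: nat
    let ?F = "mono_term (var i) (var a) 1 - mono_term (var j) (var b) 1 :: ('n, 'k) RT"
    assume "?F \<in> ?K"
    moreover have "has_bidegree ?F 1 1" by (rule has_bidegree_binomial) simp_all
    ultimately show "?F \<in> Idl\<^bsub>S_ring s\<^esub> A" using A(2) by (auto simp: A_def)
  next
    fix \<alpha> \<beta> :: "nat mon"
    let ?F = "mono_term 0 \<alpha> 1 - mono_term 0 \<beta> 1 :: ('n, 'k) RT"
    assume "?F \<in> ?K" and "mdeg \<alpha> = mdeg \<beta>"
    moreover from this(2) have "has_bidegree ?F 0 (mdeg \<beta>)" by (intro has_bidegree_binomial) simp_all
    ultimately show "?F \<in> Idl\<^bsub>S_ring s\<^esub> A" using A(2) by (auto simp: A_def)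
  qed
  then have "?K = Idl\<^bsub>S_ring s\<^esub> A" using A(3) by blast
  moreover have "\<forall>F\<in>A. has_bidegree F 1 1 \<or> (\<exists>k. has_bidegree F 0 k)" by (simp add: A_def)
  ultimately show ?thesis using fiber AK by blast
qed

end
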